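(* Let $m$ be a positive integer, let $1<s_1,\ldots,s_m<\infty$ satisfy $\sum_{i=1}^m \frac{1}{s_i}=1$, and let $w_1,\ldots,w_m$ be weights on $\mathbb{R}^n$ with $w_i\in RH_{s_i}$ for each $1\le i\le m$. Then there is a constant $C$, independent of $Q$, such that for all cubes $Q\subset\mathbb{R}^n$, $$\prod_{i=1}^m \left(\frac{1}{|Q|}\int_Q w_i^{s_i}\,dx\right)^{\frac{1}{s_i}} \leq C\,\frac{1}{|Q|}\int_Q \prod_{i=1}^m w_i\,dx.$$
   Context: A weight is a measurable function on $\mathbb{R}^n$ that is positive and finite almost everywhere. All cubes have sides parallel to the coordinate axes, and $|Q|$ denotes Lebesgue measure. For $1<s<\infty$, a locally integrable weight $w$ satisfies the reverse Hölder condition $w\in RH_s$ if $$[w]_{RH_s}=\sup_Q\left(\frac{1}{|Q|}\int_Q w^s\,dx\right)^{\frac1s}\left(\frac{1}{|Q|}\int_Q w\,dx\right)^{-1}<\infty,$$ the supremum being over all cubes $Q\subset\mathbb{R}^n$. *)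

theory Defs
  imports "HOL-Analysis.Analysis"
begin

text \<open>
  Weights are extended nonnegative functions, so all integrals are unconditionally defined
  nonnegative Lebesgue integrals, with value \<open>\<infinity>\<close> when they diverge.
\<close>

definition weight :: "(real ^ 'n \<Rightarrow> ennreal) \<Rightarrow> bool" where
  "weight w \<longleftrightarrow> w \<in> borel_measurable lebesgue \<and> (AE x in lebesgue. 0 < w x \<and> w x < \<infinity>)"

definition locally_integrable :: "(real ^ 'n \<Rightarrow> ennreal) \<Rightarrow> bool" where
  "locally_integrable w \<longleftrightarrow> w \<in> borel_measurable lebesgue \<and>
     (\<forall>K. compact K \<longrightarrow> (\<integral>\<^sup>+x\<in>K. w x \<partial>lebesgue) < \<infinity>)"

definition cubes :: "(real ^ 'n) set set" where
  "cubes = {cbox a (\<chi> i. a $ i + l) | a l. 0 < l}"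

text \<open>
  Real powers of extended nonnegative numbers; used only for exponents \<open>p > 0\<close>,
  where \<open>0\<close> and \<open>\<infinity>\<close> are fixed.
\<close>

definition epowr :: "ennreal \<Rightarrow> real \<Rightarrow> ennreal" where
  "epowr x p = (if x = \<infinity> then \<infinity> else ennreal (enn2real x powr p))"

definition average :: "(real ^ 'n) set \<Rightarrow> (real ^ 'n \<Rightarrow> ennreal) \<Rightarrow> ennreal" where
  "average Q f = 1 / emeasure lebesgue Q * (\<integral>\<^sup>+x\<in>Q. f x \<partial>lebesgue)"

definition RH_const :: "real \<Rightarrow> (real ^ 'n \<Rightarrow> ennreal) \<Rightarrow> ennreal" where
  "RH_const s w =
     (SUP Q \<in> cubes. epowr (average Q (\<lambda>x. epowr (w x) s)) (1 / s) * inverse (average Q w))"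

definition RH :: "real \<Rightarrow> (real ^ 'n \<Rightarrow> ennreal) set" where
  "RH s = {w. weight w \<and> locally_integrable w \<and> RH_const s w < \<infinity>}"

end

theory Submission
  imports Defs
begin

text \<open>
  A reverse Hoelder weight cannot be much smaller than its average on a sizable part of a
  cube: for every \<open>\<epsilon> > 0\<close> there is \<open>\<tau> > 0\<close> such that on every cube \<open>Q\<close> the set where
  \<open>w < \<tau> \<cdot> average Q w\<close> has measure at most \<open>\<epsilon> |Q|\<close> (\<open>RH_sublevel_small\<close>). Take this for each
  \<open>w\<^sub>i\<close> with \<open>\<epsilon> = 1 / (2m)\<close>. The \<open>m\<close> exceptional sets together fill at most half of \<open>Q\<close>, and on
  the rest \<open>\<Prod>i. w\<^sub>i\<close> is at least \<open>\<Prod>i. \<tau>\<^sub>i \<cdot> average Q w\<^sub>i\<close>. So the average of the product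
  dominates the product of the averages (\<open>prod_le_average_prod\<close>), and each
  \<open>average Q w\<^sub>i\<close> dominates the \<open>s\<^sub>i\<close>-mean of \<open>w\<^sub>i\<close> by the reverse Hoelder condition.

  The sublevel estimate is the strong form of Muckenhoupt's condition \<open>A\<^sub>\<infinity>\<close>. Write \<open>w(E)\<close> for the
  integral of \<open>w\<close> over \<open>E\<close>. The reverse Hoelder condition forbids \<open>w\<close> to concentrate: subsets
  of a small proportion of a cube carry a small proportion of its mass
  (\<open>RH_uniformly_small\<close>). Passing to complements, subsets of density at least some \<open>\<theta> < 1\<close>
  carry at least half of the mass. The point is to reach arbitrarily small densities: whenever
  \<open>E \<subseteq> Q\<close> and \<open>|E| \<ge> \<epsilon> |Q|\<close>, also \<open>w(E) \<ge> c w(Q)\<close>, with \<open>c\<close> depending only on \<open>\<epsilon>\<close> and \<open>w\<close>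
  (\<open>uniform_lower_bound\<close>). Applied to the set where \<open>w < \<tau> \<cdot> average Q w\<close>, whose mass is at most
  \<open>\<tau> w(Q)\<close>, this excludes that the set has proportion \<open>\<epsilon>\<close> once \<open>\<tau> < c\<close>.

  Small densities are reached by a stopping-time argument (\<open>dyadic_growth\<close>): a set \<open>E\<close> of density
  at most \<open>\<theta>\<close> in \<open>Q\<close> is replaced by the union \<open>F\<close> of the maximal dyadic subcubes having a child
  in which \<open>E\<close> has density more than \<open>\<theta>\<close>. Then \<open>|F| \<ge> |E| / \<theta>\<close>, while doubling and the density bound
  give \<open>w(F) \<le> C w(E)\<close>. The number of steps that bring the density from \<open>\<epsilon>\<close> up to \<open>\<theta>\<close> depends
  only on \<open>\<epsilon>\<close> and \<open>\<theta>\<close>. Working with finite unions of dyadic cubes makes the stopping-time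
  construction a plain induction; an arbitrary measurable set is approximated by such unions.
\<close>

section \<open>Half-open cubes\<close>

text \<open>
  Half-open cubes split exactly into disjoint half-open children, so the dyadic decompositions
  below involve no exceptional null sets; a closed cube differs from its half-open version by a
  null set only.
\<close>

definition hcube :: "real ^ 'n \<Rightarrow> real \<Rightarrow> (real ^ 'n) set" where
  "hcube a l = {x. \<forall>i. a $ i \<le> x $ i \<and> x $ i < a $ i + l}"

lemma hcube_subset_cbox: "hcube a l \<subseteq> cbox a (\<chi> i. a $ i + l)"
  by (auto simp: hcube_def mem_box_cart) (metis less_imp_le)

lemma negligible_cbox_minus_hcube: "negligible (cbox a (\<chi> i. a $ i + l) - hcube a l)"
proof (rule negligible_subset[OF negligible_frontier_interval])
  show "cbox a (\<chi> i. a $ i + l) - hcube a l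
      \<subseteq> cbox a (\<chi> i. a $ i + l) - box a (\<chi> i. a $ i + l)"
    by (force simp: hcube_def mem_box_cart intro: less_imp_le)
qed

lemma cbox_minus_hcube_null: "cbox a (\<chi> i. a $ i + l) - hcube a l \<in> null_sets lebesgue"
  using negligible_cbox_minus_hcube negligible_iff_null_sets by blast

lemma hcube_sets [measurable]: "hcube a l \<in> sets lebesgue"
proof -
  have "hcube a l = cbox a (\<chi> i. a $ i + l) - (cbox a (\<chi> i. a $ i + l) - hcube a l)"
    using hcube_subset_cbox by blast
  moreover have "cbox a (\<chi> i. a $ i + l) - hcube a l \<in> sets lebesgue"
    using cbox_minus_hcube_null by blast
  ultimately show ?thesis
    by (metis sets.Diff fmeasurableD lmeasurable_cbox)
qed

lemma hcube_lmeasurable: "hcube a l \<in> lmeasurable"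
  by (rule fmeasurableI2[OF lmeasurable_cbox hcube_subset_cbox hcube_sets])

lemma AE_hcube_iff_cbox: "AE x in lebesgue. x \<in> hcube a l \<longleftrightarrow> x \<in> cbox a (\<chi> i. a $ i + l)"
  by (rule AE_I'[OF cbox_minus_hcube_null[of a l]]) (use hcube_subset_cbox in blast)

lemma emeasure_cube:
  fixes a :: "real ^ 'n"
  assumes "0 < l"
  shows "emeasure lebesgue (cbox a (\<chi> i. a $ i + l)) = ennreal (l ^ CARD('n))"
proof -
  have "cbox a (\<chi> i. a $ i + l) \<noteq> {}"
    using assms by (auto simp: interval_ne_empty_cart)
  then have "measure lebesgue (cbox a (\<chi> i. a $ i + l)) = l ^ CARD('n)"
    using assms by (simp add: content_cbox_cart)
  then show ?thesis
    by (metis emeasure_eq_measure2 lmeasurable_cbox)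
qed

lemma emeasure_hcube:
  fixes a :: "real ^ 'n"
  assumes "0 < l"
  shows "emeasure lebesgue (hcube a l) = ennreal (l ^ CARD('n))"
  using emeasure_eq_AE[OF AE_hcube_iff_cbox[of a l]] emeasure_cube[OF assms, of a] by simp

lemma measure_hcube:
  fixes a :: "real ^ 'n"
  assumes "0 < l"
  shows "measure lebesgue (hcube a l) = l ^ CARD('n)"
  using emeasure_hcube[OF assms, of a] assms by (simp add: measure_def)

text \<open>
  With \<open>h = l / 2\<close> these are the lower corners of the \<open>2\<^sup>n\<close> children of \<open>hcube a l\<close>, indexed by
  the set \<open>S\<close> of coordinates in which the child is the upper half.
\<close>

definition corner :: "real ^ 'n \<Rightarrow> real \<Rightarrow> 'n set \<Rightarrow> real ^ 'n" where
  "corner a h S = (\<chi> i. a $ i + (if i \<in> S then h else 0))"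

lemma hcube_eq_UN_children:
  assumes "0 < l"
  shows "hcube a l = (\<Union>S. hcube (corner a (l / 2) S) (l / 2))"
proof
  show "hcube a l \<subseteq> (\<Union>S. hcube (corner a (l / 2) S) (l / 2))"
  proof
    fix x assume x: "x \<in> hcube a l"
    have "x \<in> hcube (corner a (l / 2) {i. a $ i + l / 2 \<le> x $ i}) (l / 2)"
      using x by (simp add: hcube_def corner_def not_le add.assoc)
    then show "x \<in> (\<Union>S. hcube (corner a (l / 2) S) (l / 2))" by blast
  qed
  show "(\<Union>S. hcube (corner a (l / 2) S) (l / 2)) \<subseteq> hcube a l"
  proof
    fix x assume "x \<in> (\<Union>S. hcube (corner a (l / 2) S) (l / 2))"
    then obtain S where S: "x \<in> hcube (corner a (l / 2) S) (l / 2)" by blast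
    have "a $ i \<le> x $ i \<and> x $ i < a $ i + l" for i
    proof -
      have "a $ i + (if i \<in> S then l / 2 else 0) \<le> x $ i"
        and "x $ i < a $ i + (if i \<in> S then l / 2 else 0) + l / 2"
        using S by (auto simp: hcube_def corner_def)
      then show ?thesis
        using assms by (auto split: if_splits)
    qed
    then show "x \<in> hcube a l" by (simp add: hcube_def)
  qed
qed

lemma disjoint_children:
  fixes a :: "real ^ 'n"
  shows "disjoint_family (\<lambda>S. hcube (corner a (l / 2) S) (l / 2))"
proof (unfold disjoint_family_on_def, intro ballI impI)
  fix S T :: "'n set"
  assume "S \<noteq> T"
  then obtain i where i: "i \<in> S \<longleftrightarrow> i \<notin> T" by blast
  show "hcube (corner a (l / 2) S) (l / 2) \<inter> hcube (corner a (l / 2) T) (l / 2) = {}"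
  proof (rule ccontr)
    assume "\<not> ?thesis"
    then obtain x where x: "x \<in> hcube (corner a (l / 2) S) (l / 2)"
      "x \<in> hcube (corner a (l / 2) T) (l / 2)" by blast
    then show False
      using i by (cases "i \<in> S") (auto simp: hcube_def corner_def dest!: spec[of _ i])
  qed
qed

section \<open>Finite unions of dyadic subcubes\<close>

text \<open>
  The finite unions of dyadic subcubes of \<open>hcube a l\<close>. Generating them along the subdivision tree
  gives the induction principle on which the stopping-time argument rests.
\<close>

inductive dyadic_set :: "real ^ 'n \<Rightarrow> real \<Rightarrow> (real ^ 'n) set \<Rightarrow> bool" where
  empty: "dyadic_set a l {}"
| full: "dyadic_set a l (hcube a l)"
| split: "(\<And>S. dyadic_set (corner a (l / 2) S) (l / 2) (E S)) \<Longrightarrow> dyadic_set a l (\<Union>S. E S)"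

lemma dyadic_set_subset: "dyadic_set a l E \<Longrightarrow> 0 < l \<Longrightarrow> E \<subseteq> hcube a l"
proof (induction rule: dyadic_set.induct)
  case (split a l E)
  have "E S \<subseteq> hcube (corner a (l / 2) S) (l / 2)" for S
    using split by simp
  then show ?case
    unfolding hcube_eq_UN_children[OF split.prems] by blast
qed auto

lemma dyadic_set_sets: "dyadic_set a l E \<Longrightarrow> E \<in> sets lebesgue"
  by (induction rule: dyadic_set.induct) (auto intro!: sets.finite_UN)

text \<open>
  The union of those generation \<open>N\<close> subcubes of \<open>hcube a l\<close> that lie inside \<open>U\<close>. For open \<open>U\<close>
  these sets exhaust the part of \<open>U\<close> in the cube.
\<close>

primrec inner_dyadic :: "(real ^ 'n) set \<Rightarrow> nat \<Rightarrow> real ^ 'n \<Rightarrow> real \<Rightarrow> (real ^ 'n) set" where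
  "inner_dyadic U 0 a l = (if hcube a l \<subseteq> U then hcube a l else {})"
| "inner_dyadic U (Suc N) a l = (\<Union>S. inner_dyadic U N (corner a (l / 2) S) (l / 2))"

lemma dyadic_set_inner_dyadic: "dyadic_set a l (inner_dyadic U N a l)"
  by (induction N arbitrary: a l) (auto intro: dyadic_set.intros)

lemma inner_dyadic_subset: "inner_dyadic U N a l \<subseteq> U"
  by (induction N arbitrary: a l) auto

lemma inner_dyadic_mono:
  "0 < l \<Longrightarrow> inner_dyadic U N a l \<subseteq> inner_dyadic U (Suc N) a l"
proof (induction N arbitrary: a l)
  case 0
  then show ?case
    using hcube_eq_UN_children[of l a] by auto
next
  case (Suc N)
  have "inner_dyadic U N (corner a (l / 2) S) (l / 2)
      \<subseteq> inner_dyadic U (Suc N) (corner a (l / 2) S) (l / 2)" for S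
    by (rule Suc.IH) (use Suc.prems in simp)
  then show ?case
    unfolding inner_dyadic.simps(2)[of _ "Suc N"] inner_dyadic.simps(2)[of _ N a] by blast
qed

text \<open>
  The generation \<open>N\<close> subcube containing \<open>x\<close> has side \<open>l / 2 ^ N\<close>, hence diameter at most
  \<open>n l / 2 ^ N\<close> by comparison with the \<open>l\<^sup>1\<close> norm, so it stays inside the ball.
\<close>

lemma inner_dyadic_covers:
  fixes a x :: "real ^ 'n"
  shows "\<lbrakk>0 < l; x \<in> hcube a l; ball x r \<subseteq> U; real CARD('n) * l / 2 ^ N < r\<rbrakk>
    \<Longrightarrow> x \<in> inner_dyadic U N a l"
proof (induction N arbitrary: a l)
  case 0
  have "y \<in> U" if y: "y \<in> hcube a l" for y
  proof -
    have "\<bar>(x - y) $ i\<bar> \<le> l" for i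
      using y 0(2) by (auto simp: hcube_def abs_le_iff dest!: spec[of _ i])
    then have "norm (x - y) \<le> (\<Sum>i\<in>(UNIV :: 'n set). l)"
      by (intro order_trans[OF norm_le_l1_cart] sum_mono)
    also have "\<dots> < r"
      using 0(4) by simp
    finally show ?thesis
      using 0(3) by (auto simp: dist_norm)
  qed
  then show ?case
    using 0(2) by auto
next
  case (Suc N)
  obtain S where S: "x \<in> hcube (corner a (l / 2) S) (l / 2)"
    using Suc.prems(1,2) hcube_eq_UN_children[of l a] by blast
  have "x \<in> inner_dyadic U N (corner a (l / 2) S) (l / 2)"
    by (rule Suc.IH) (use Suc.prems S in \<open>auto simp: field_simps\<close>)
  then show ?case by auto
qed

lemma UN_inner_dyadic:
  fixes a :: "real ^ 'n"
  assumes "0 < l" "open U"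
  shows "(\<Union>N. inner_dyadic U N a l) = U \<inter> hcube a l"
proof
  show "(\<Union>N. inner_dyadic U N a l) \<subseteq> U \<inter> hcube a l"
    using inner_dyadic_subset dyadic_set_subset[OF dyadic_set_inner_dyadic assms(1)] by blast
  show "U \<inter> hcube a l \<subseteq> (\<Union>N. inner_dyadic U N a l)"
  proof
    fix x assume x: "x \<in> U \<inter> hcube a l"
    then obtain r where r: "r > 0" "ball x r \<subseteq> U"
      using assms(2) by (meson IntD1 open_contains_ball)
    obtain N where "real CARD('n) * l / r < 2 ^ N"
      using real_arch_pow[of 2] by auto
    then have "real CARD('n) * l / 2 ^ N < r"
      using r by (simp add: field_simps)
    then show "x \<in> (\<Union>N. inner_dyadic U N a l)"
      using inner_dyadic_covers[of l x a r U N] assms x r by blast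
  qed
qed

text \<open>
  Enclose \<open>E\<close> in an open set of almost the same measure and exhaust that open set from inside.
\<close>

lemma dyadic_approximation:
  fixes a :: "real ^ 'n"
  assumes "0 < l" "E \<in> sets lebesgue" "E \<subseteq> hcube a l" "0 < \<eta>"
  obtains D where "dyadic_set a l D" "measure lebesgue (E - D) < \<eta>" "measure lebesgue (D - E) < \<eta>"
proof -
  obtain U where U: "open U" "E \<subseteq> U" "U - E \<in> lmeasurable" "emeasure lebesgue (U - E) < ennreal \<eta>"
    using sets_lebesgue_outer_open[OF assms(2,4)] by blast
  define I where "I N = inner_dyadic U N a l" for N
  have I_sets: "I N \<in> sets lebesgue" for N
    unfolding I_def by (rule dyadic_set_sets[OF dyadic_set_inner_dyadic])
  have fin: "E - I N \<in> lmeasurable" for N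
    by (rule fmeasurableI2[OF hcube_lmeasurable[of a l]]) (use assms I_sets in auto)
  have "(\<lambda>N. measure lebesgue (E - I N)) \<longlonglongrightarrow> measure lebesgue (\<Inter>N. E - I N)"
  proof (rule Lim_measure_decseq)
    show "range (\<lambda>N. E - I N) \<subseteq> sets lebesgue"
      using assms I_sets by auto
    show "decseq (\<lambda>N. E - I N)"
      unfolding I_def using inner_dyadic_mono[OF assms(1), of U] by (intro decseq_SucI) blast
    show "emeasure lebesgue (E - I N) \<noteq> \<infinity>" for N
      using fin[of N] by (auto simp: fmeasurable_def)
  qed
  moreover have "(\<Inter>N. E - I N) = {}"
    using UN_inner_dyadic[OF assms(1) U(1), of a] assms(3) U(2) unfolding I_def by blast
  ultimately have "(\<lambda>N. measure lebesgue (E - I N)) \<longlonglongrightarrow> 0"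
    by (metis measure_empty)
  then have "eventually (\<lambda>N. measure lebesgue (E - I N) < \<eta>) sequentially"
    using assms(4) by (rule order_tendstoD)
  then obtain N where N: "measure lebesgue (E - I N) < \<eta>"
    by (auto simp: eventually_sequentially)
  have "measure lebesgue (I N - E) \<le> measure lebesgue (U - E)"
    using inner_dyadic_subset[of U N a l] I_sets assms(2)
    by (intro measure_mono_fmeasurable U(3)) (auto simp: I_def)
  also have "\<dots> < \<eta>"
    using U(3,4) assms(4) by (simp add: emeasure_eq_measure2 ennreal_less_iff)
  finally show ?thesis
    using that N dyadic_set_inner_dyadic[of a l U N] by (auto simp: I_def)
qed

section \<open>Measures that do not concentrate on small parts of cubes\<close>

text \<open>
  The quantitative absolute continuity that reverse Hoelder weights enjoy:
  \<open>\<delta>\<close> depends on \<open>\<kappa>\<close> but not on the cube.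
\<close>

locale uniformly_small_on_cubes =
  fixes \<mu> :: "(real ^ 'n) measure"
  assumes sets_eq [measurable_cong]: "sets \<mu> = sets lebesgue"
    and finite_hcube: "emeasure \<mu> (hcube a l) < \<infinity>"
    and small: "0 < \<kappa> \<Longrightarrow> \<exists>\<delta>>0. \<forall>a l E. 0 < l \<longrightarrow> E \<in> sets lebesgue \<longrightarrow> E \<subseteq> hcube a l \<longrightarrow>
      measure lebesgue E \<le> \<delta> * l ^ CARD('n) \<longrightarrow> measure \<mu> E \<le> \<kappa> * measure \<mu> (hcube a l)"
begin

lemma fmeasurable_subset:
  assumes "E \<in> sets lebesgue" "E \<subseteq> hcube a l"
  shows "E \<in> fmeasurable \<mu>"
proof (rule fmeasurableI2)
  show "hcube a l \<in> fmeasurable \<mu>"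
    by (rule fmeasurableI) (use finite_hcube in \<open>auto simp: sets_eq\<close>)
qed (use assms in \<open>auto simp: sets_eq\<close>)

lemma measure_mono_in_hcube:
  assumes "D \<in> sets lebesgue" "E \<in> sets lebesgue" "D \<subseteq> E" "E \<subseteq> hcube a l"
  shows "measure \<mu> D \<le> measure \<mu> E"
  by (rule measure_mono_fmeasurable) (use assms fmeasurable_subset in \<open>auto simp: sets_eq\<close>)

lemma measure_Diff_in_hcube:
  assumes "D \<in> sets lebesgue" "E \<in> sets lebesgue" "D \<subseteq> E" "E \<subseteq> hcube a l"
  shows "measure \<mu> (E - D) = measure \<mu> E - measure \<mu> D"
    and "measure lebesgue (E - D) = measure lebesgue E - measure lebesgue D"
proof -
  show "measure \<mu> (E - D) = measure \<mu> E - measure \<mu> D"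
    by (rule measurable_measure_Diff) (use assms fmeasurable_subset in \<open>auto simp: sets_eq\<close>)
  have "E \<in> lmeasurable"
    by (rule fmeasurableI2[OF hcube_lmeasurable]) (use assms in auto)
  then show "measure lebesgue (E - D) = measure lebesgue E - measure lebesgue D"
    by (rule measurable_measure_Diff) (use assms in auto)
qed

lemma measure_UN_children:
  assumes "0 < l" "\<And>S. E S \<in> sets lebesgue" "\<And>S. E S \<subseteq> hcube (corner a (l / 2) S) (l / 2)"
  shows "measure \<mu> (\<Union>S. E S) = (\<Sum>S\<in>UNIV. measure \<mu> (E S))"
    and "measure lebesgue (\<Union>S. E S) = (\<Sum>S\<in>UNIV. measure lebesgue (E S))"
proof -
  have disj: "disjoint_family E"
    using disjoint_children[of a l] assms(3) unfolding disjoint_family_on_def by blast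
  have "E S \<in> fmeasurable \<mu>" "E S \<in> lmeasurable" for S
    using fmeasurable_subset[OF assms(2,3)] fmeasurableI2[OF hcube_lmeasurable assms(3,2)] by auto
  then have "emeasure \<mu> (E S) \<noteq> \<infinity>" "emeasure lebesgue (E S) \<noteq> \<infinity>" for S
    using fmeasurableD2 by (metis infinity_ennreal_def)+
  then show "measure \<mu> (\<Union>S. E S) = (\<Sum>S\<in>UNIV. measure \<mu> (E S))"
    and "measure lebesgue (\<Union>S. E S) = (\<Sum>S\<in>UNIV. measure lebesgue (E S))"
    using disj assms(2) by (auto intro!: measure_finite_Union simp: sets_eq)
qed

text \<open>
  The complement of a set of density at least \<open>\<theta>\<close> is so small that it carries at most half of the
  mass of the cube.
\<close>

lemma density_threshold:
  obtains \<theta> where "0 < \<theta>" "\<theta> < 1"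
    "\<And>a l E. \<lbrakk>0 < l; E \<in> sets lebesgue; E \<subseteq> hcube a l; \<theta> * l ^ CARD('n) \<le> measure lebesgue E\<rbrakk>
      \<Longrightarrow> measure \<mu> (hcube a l) \<le> 2 * measure \<mu> E"
proof -
  obtain \<delta> where \<delta>: "\<delta> > 0" and *: "\<And>a l E. \<lbrakk>0 < l; E \<in> sets lebesgue; E \<subseteq> hcube a l;
      measure lebesgue E \<le> \<delta> * l ^ CARD('n)\<rbrakk> \<Longrightarrow> measure \<mu> E \<le> 1 / 2 * measure \<mu> (hcube a l)"
    using small[of "1 / 2"] by auto
  define \<theta> where "\<theta> = 1 - min \<delta> (1 / 2)"
  show ?thesis
  proof
    show "0 < \<theta>" "\<theta> < 1"
      using \<delta> by (auto simp: \<theta>_def)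
    fix a :: "real ^ 'n" and l E
    assume A: "0 < l" "E \<in> sets lebesgue" "E \<subseteq> hcube a l"
      "\<theta> * l ^ CARD('n) \<le> measure lebesgue E"
    have "measure lebesgue (hcube a l - E) = l ^ CARD('n) - measure lebesgue E"
      using measure_Diff_in_hcube(2)[of E "hcube a l" a l] A by (simp add: measure_hcube)
    also have "\<dots> \<le> (1 - \<theta>) * l ^ CARD('n)"
      using A by (simp add: algebra_simps)
    also have "\<dots> \<le> \<delta> * l ^ CARD('n)"
      using A(1) by (intro mult_right_mono) (auto simp: \<theta>_def)
    finally have "measure \<mu> (hcube a l - E) \<le> 1 / 2 * measure \<mu> (hcube a l)"
      using A by (intro *) auto
    then show "measure \<mu> (hcube a l) \<le> 2 * measure \<mu> E"
      using measure_Diff_in_hcube(1)[of E "hcube a l" a l] A by simp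
  qed
qed

text \<open>
  A child fills only the proportion \<open>1 / 2 ^ n\<close> of its parent, possibly far below the threshold
  \<open>\<theta>\<close>. So the parent is shrunk gradually towards its corner at the child, at bounded cost in each
  step.
\<close>

lemma doubling:
  obtains D where "1 \<le> D"
    "\<And>a l S. 0 < l \<Longrightarrow> measure \<mu> (hcube a l) \<le> D * measure \<mu> (hcube (corner a (l / 2) S) (l / 2))"
proof -
  obtain \<theta> where \<theta>: "0 < \<theta>" "\<theta> < 1"
    and half: "\<And>a l E. \<lbrakk>0 < l; E \<in> sets lebesgue; E \<subseteq> hcube a l;
      \<theta> * l ^ CARD('n) \<le> measure lebesgue E\<rbrakk> \<Longrightarrow> measure \<mu> (hcube a l) \<le> 2 * measure \<mu> E"
    using density_threshold by metis
  \<comment> \<open>Shrinking a cube by the factor \<open>r\<close> keeps the proportion \<open>\<theta>\<close> of its volume, so it at most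
    halves the mass; a fixed number \<open>k\<close> of such steps brings the cube below half its side.\<close>
  define r where "r = root CARD('n) \<theta>"
  have r: "0 < r" "r < 1" "r ^ CARD('n) = \<theta>"
    using \<theta> by (auto simp: r_def)
  obtain k where k: "r ^ k < 1 / 2"
    using real_arch_pow_inv[of "1 / 2" r] r by auto
  have shrink: "measure \<mu> (hcube a l) \<le> 2 ^ j * measure \<mu> (hcube (corner a (l - r ^ j * l) S) (r ^ j * l))"
    if l: "0 < l" for a l S j
  proof (induction j)
    case 0
    have "corner a 0 S = a" by (simp add: corner_def vec_eq_iff)
    then show ?case by simp
  next
    case (Suc j)
    let ?b = "corner a (l - r ^ j * l) S"
    have sub: "hcube (corner a (l - r ^ Suc j * l) S) (r ^ Suc j * l) \<subseteq> hcube ?b (r ^ j * l)"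
    proof
      fix x assume x: "x \<in> hcube (corner a (l - r ^ Suc j * l) S) (r ^ Suc j * l)"
      have le: "r ^ Suc j * l \<le> r ^ j * l"
        using r l by (simp add: mult_left_le_one_le)
      have "?b $ i \<le> x $ i \<and> x $ i < ?b $ i + r ^ j * l" for i
      proof -
        have "a $ i + (if i \<in> S then l - r ^ Suc j * l else 0) \<le> x $ i"
          and "x $ i < a $ i + (if i \<in> S then l - r ^ Suc j * l else 0) + r ^ Suc j * l"
          using x unfolding hcube_def corner_def by auto
        then show ?thesis
          using le unfolding corner_def by (auto split: if_splits)
      qed
      then show "x \<in> hcube ?b (r ^ j * l)" by (simp add: hcube_def)
    qed
    have "measure \<mu> (hcube ?b (r ^ j * l))
        \<le> 2 * measure \<mu> (hcube (corner a (l - r ^ Suc j * l) S) (r ^ Suc j * l))"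
    proof (rule half[OF _ _ sub])
      show "\<theta> * (r ^ j * l) ^ CARD('n)
          \<le> measure lebesgue (hcube (corner a (l - r ^ Suc j * l) S) (r ^ Suc j * l))"
        using r l by (simp add: measure_hcube power_mult_distrib)
    qed (use r l in auto)
    with Suc show ?case
      by (simp add: order_trans)
  qed
  show ?thesis
  proof
    show "1 \<le> (2 :: real) ^ k" by simp
    fix a :: "real ^ 'n" and l :: real and S
    assume l: "0 < l"
    have le: "r ^ k * l \<le> l / 2"
      using k l by (simp add: field_simps)
    have "hcube (corner a (l - r ^ k * l) S) (r ^ k * l) \<subseteq> hcube (corner a (l / 2) S) (l / 2)"
    proof
      fix x assume x: "x \<in> hcube (corner a (l - r ^ k * l) S) (r ^ k * l)"
      have "corner a (l / 2) S $ i \<le> x $ i \<and> x $ i < corner a (l / 2) S $ i + l / 2" for i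
      proof -
        have "a $ i + (if i \<in> S then l - r ^ k * l else 0) \<le> x $ i"
          and "x $ i < a $ i + (if i \<in> S then l - r ^ k * l else 0) + r ^ k * l"
          using x unfolding hcube_def corner_def by auto
        then show ?thesis
          using le unfolding corner_def by (auto split: if_splits)
      qed
      then show "x \<in> hcube (corner a (l / 2) S) (l / 2)" by (simp add: hcube_def)
    qed
    then have "measure \<mu> (hcube (corner a (l - r ^ k * l) S) (r ^ k * l))
        \<le> measure \<mu> (hcube (corner a (l / 2) S) (l / 2))"
      by (intro measure_mono_in_hcube) auto
    then show "measure \<mu> (hcube a l) \<le> 2 ^ k * measure \<mu> (hcube (corner a (l / 2) S) (l / 2))"
      by (intro order_trans[OF shrink[OF l, of a k S]] mult_left_mono) auto
  qed
qed

text \<open>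
  Here \<open>F\<close> consists of the largest dyadic subcubes that have a child in which \<open>E\<close> has density more
  than \<open>\<theta>\<close>. The density of \<open>E\<close> in such a subcube is itself at most \<open>\<theta>\<close>, as the selection did not
  stop earlier, which makes \<open>F\<close> larger than \<open>E\<close> by the factor \<open>1 / \<theta>\<close>; and the mass of the subcube
  is controlled by that of the dense child, hence by that of \<open>E\<close> in the child. The induction over
  dyadic sets performs the selection: a dense child makes the whole cube part of \<open>F\<close>, and
  otherwise the sets found in the children are put together.
\<close>

lemma dyadic_growth:
  assumes \<theta>: "0 < \<theta>" "\<theta> < 1"
    and half: "\<And>a l E. \<lbrakk>0 < l; E \<in> sets lebesgue; E \<subseteq> hcube a l;
      \<theta> * l ^ CARD('n) \<le> measure lebesgue E\<rbrakk> \<Longrightarrow> measure \<mu> (hcube a l) \<le> 2 * measure \<mu> E"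
    and D: "1 \<le> D" "\<And>a l S. 0 < l \<Longrightarrow>
      measure \<mu> (hcube a l) \<le> D * measure \<mu> (hcube (corner a (l / 2) S) (l / 2))"
  shows "dyadic_set a l E \<Longrightarrow> 0 < l \<Longrightarrow> measure lebesgue E \<le> \<theta> * l ^ CARD('n) \<Longrightarrow>
    \<exists>F. dyadic_set a l F \<and> measure lebesgue E \<le> \<theta> * measure lebesgue F
      \<and> measure \<mu> F \<le> 2 * D * measure \<mu> E"
proof (induction rule: dyadic_set.induct)
  case (empty a l)
  show ?case
    by (rule exI[of _ "{}"]) (auto intro: dyadic_set.empty)
next
  case (full a l)
  \<comment> \<open>The full cube has density \<open>1 > \<theta>\<close>, so this case does not occur.\<close>
  then have "l ^ CARD('n) \<le> \<theta> * l ^ CARD('n)" by (simp add: measure_hcube)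
  then have False using \<theta> full by simp
  then show ?case ..
next
  case (split a l E)
  let ?Q = "\<lambda>S. hcube (corner a (l / 2) S) (l / 2)"
  have h: "0 < l / 2" using split.prems by simp
  have E: "E S \<in> sets lebesgue" "E S \<subseteq> ?Q S" for S
    using dyadic_set_sets dyadic_set_subset[OF _ h] split.hyps by blast+
  have UE: "(\<Union>S. E S) \<in> sets lebesgue" "(\<Union>S. E S) \<subseteq> hcube a l"
    using E hcube_eq_UN_children[OF split.prems(1), of a] by (auto intro!: sets.finite_UN; blast)+
  show ?case
  proof (cases "\<exists>S. \<theta> * (l / 2) ^ CARD('n) < measure lebesgue (E S)")
    case True
    then obtain S where S: "\<theta> * (l / 2) ^ CARD('n) \<le> measure lebesgue (E S)"
      using less_imp_le by blast
    have "measure \<mu> (hcube a l) \<le> D * measure \<mu> (?Q S)"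
      by (rule D(2)) (rule split.prems)
    also have "\<dots> \<le> D * (2 * measure \<mu> (E S))"
      using D(1) half[OF h E S] by (intro mult_left_mono) auto
    also have "\<dots> \<le> D * (2 * measure \<mu> (\<Union>S. E S))"
      using D(1) E(1) UE by (intro mult_left_mono measure_mono_in_hcube[where a=a and l=l]) auto
    finally show ?thesis
      using split.prems by (intro exI[of _ "hcube a l"])
        (auto intro: dyadic_set.full simp: measure_hcube mult_ac)
  next
    case False
    then have "\<forall>S. \<exists>F. dyadic_set (corner a (l / 2) S) (l / 2) F \<and>
        measure lebesgue (E S) \<le> \<theta> * measure lebesgue F \<and> measure \<mu> F \<le> 2 * D * measure \<mu> (E S)"
      using split.IH[OF h] by (auto simp: not_less)
    then obtain F where F: "\<And>S. dyadic_set (corner a (l / 2) S) (l / 2) (F S)"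
      "\<And>S. measure lebesgue (E S) \<le> \<theta> * measure lebesgue (F S)"
      "\<And>S. measure \<mu> (F S) \<le> 2 * D * measure \<mu> (E S)"
      by metis
    note F' = dyadic_set_sets[OF F(1)] dyadic_set_subset[OF F(1) h]
    have "measure lebesgue (\<Union>S. E S) \<le> \<theta> * measure lebesgue (\<Union>S. F S)"
      unfolding measure_UN_children(2)[of l E a, OF split.prems(1) E]
        measure_UN_children(2)[of l F a, OF split.prems(1) F'] sum_distrib_left
      by (intro sum_mono F(2))
    moreover have "measure \<mu> (\<Union>S. F S) \<le> 2 * D * measure \<mu> (\<Union>S. E S)"
      unfolding measure_UN_children(1)[of l E a, OF split.prems(1) E]
        measure_UN_children(1)[of l F a, OF split.prems(1) F'] sum_distrib_left
      by (intro sum_mono F(3))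
    ultimately show ?thesis
      using dyadic_set.split[of a l F] F(1) by blast
  qed
qed

text \<open>
  Each growth step multiplies the volume by at least \<open>1 / \<theta>\<close> and the mass by at most \<open>2 D\<close>. Starting
  from density \<open>\<epsilon> \<ge> \<theta> ^ Suc k\<close>, at most \<open>k\<close> steps lead to density at least \<open>\<theta>\<close>, where the set carries half
  of the mass of the cube.
\<close>

lemma dyadic_lower_bound:
  assumes "0 < \<epsilon>"
  obtains c where "0 < c" "\<And>a l E. \<lbrakk>0 < l; dyadic_set a l E; \<epsilon> * l ^ CARD('n) \<le> measure lebesgue E\<rbrakk>
    \<Longrightarrow> c * measure \<mu> (hcube a l) \<le> measure \<mu> E"
proof -
  obtain \<theta> where \<theta>: "0 < \<theta>" "\<theta> < 1"
    and half: "\<And>a l E. \<lbrakk>0 < l; E \<in> sets lebesgue; E \<subseteq> hcube a l;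
      \<theta> * l ^ CARD('n) \<le> measure lebesgue E\<rbrakk> \<Longrightarrow> measure \<mu> (hcube a l) \<le> 2 * measure \<mu> E"
    using density_threshold by metis
  obtain D where D: "1 \<le> D" "\<And>a l S. 0 < l \<Longrightarrow>
      measure \<mu> (hcube a l) \<le> D * measure \<mu> (hcube (corner a (l / 2) S) (l / 2))"
    using doubling by metis
  have iter: "measure \<mu> (hcube a l) \<le> 2 * (2 * D) ^ k * measure \<mu> E"
    if "0 < l" "dyadic_set a l E" "\<theta> ^ Suc k * l ^ CARD('n) \<le> measure lebesgue E" for a l E k
    using that(2,3)
  proof (induction k arbitrary: E)
    case 0
    then show ?case
      using half[OF that(1) dyadic_set_sets dyadic_set_subset[OF _ that(1)]] by simp
  next
    case (Suc k)
    show ?case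
    proof (cases "measure lebesgue E \<le> \<theta> * l ^ CARD('n)")
      case True
      have "\<exists>F. dyadic_set a l F \<and> measure lebesgue E \<le> \<theta> * measure lebesgue F
          \<and> measure \<mu> F \<le> 2 * D * measure \<mu> E"
        by (rule dyadic_growth[where \<theta> = \<theta> and D = D])
          (fact \<theta> half D Suc.prems(1) that(1) True)+
      then obtain F where F: "dyadic_set a l F" "measure lebesgue E \<le> \<theta> * measure lebesgue F"
        "measure \<mu> F \<le> 2 * D * measure \<mu> E"
        by blast
      have "\<theta> * (\<theta> ^ Suc k * l ^ CARD('n)) \<le> \<theta> * measure lebesgue F"
        using order_trans[OF Suc.prems(2) F(2)] by (simp add: mult.assoc)
      then have "\<theta> ^ Suc k * l ^ CARD('n) \<le> measure lebesgue F"
        using \<theta>(1) by (simp only: mult_le_cancel_left_pos)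
      then have "measure \<mu> (hcube a l) \<le> 2 * (2 * D) ^ k * measure \<mu> F"
        by (rule Suc.IH[OF F(1)])
      also have "\<dots> \<le> 2 * (2 * D) ^ k * (2 * D * measure \<mu> E)"
        using D(1) F(3) by (intro mult_left_mono) auto
      finally show ?thesis by (simp add: mult_ac)
    next
      case False
      then have "measure \<mu> (hcube a l) \<le> 2 * 1 * measure \<mu> E"
        using half[OF that(1) dyadic_set_sets dyadic_set_subset[OF _ that(1)]] Suc.prems(1) by simp
      also have "\<dots> \<le> 2 * (2 * D) ^ Suc k * measure \<mu> E"
        using D(1) by (intro mult_right_mono mult_left_mono one_le_power) auto
      finally show ?thesis .
    qed
  qed
  obtain k where k: "\<theta> ^ k < \<epsilon>"
    using real_arch_pow_inv[OF assms \<theta>(2)] by blast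
  have k': "\<theta> ^ Suc k \<le> \<epsilon>"
    using k \<theta> by (simp add: mult_left_le_one_le order_trans[OF _ less_imp_le[OF k]])
  show ?thesis
  proof
    show "0 < 1 / (2 * (2 * D) ^ k)"
      using D(1) by simp
    fix a :: "real ^ 'n" and l E
    assume A: "0 < l" "dyadic_set a l E" "\<epsilon> * l ^ CARD('n) \<le> measure lebesgue E"
    have "\<theta> ^ Suc k * l ^ CARD('n) \<le> measure lebesgue E"
      using A k' by (intro order_trans[OF mult_right_mono A(3)]) auto
    then show "1 / (2 * (2 * D) ^ k) * measure \<mu> (hcube a l) \<le> measure \<mu> E"
      using iter[OF A(1,2)] D(1) by (simp add: field_simps)
  qed
qed

text \<open>
  Replace \<open>E\<close> by a dyadic set \<open>D\<close> so close to it that \<open>D\<close> still has density \<open>\<epsilon> / 2\<close>, while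
  \<open>D - E\<close> carries at most half of the mass that the dyadic case guarantees for \<open>D\<close>.
\<close>

theorem uniform_lower_bound:
  assumes "0 < \<epsilon>"
  obtains c where "0 < c" "\<And>a l E. \<lbrakk>0 < l; E \<in> sets lebesgue; E \<subseteq> hcube a l;
      \<epsilon> * l ^ CARD('n) \<le> measure lebesgue E\<rbrakk> \<Longrightarrow> c * measure \<mu> (hcube a l) \<le> measure \<mu> E"
proof -
  obtain c where c: "0 < c" and dyadic: "\<And>a l E. \<lbrakk>0 < l; dyadic_set a l E;
      \<epsilon> / 2 * l ^ CARD('n) \<le> measure lebesgue E\<rbrakk> \<Longrightarrow> c * measure \<mu> (hcube a l) \<le> measure \<mu> E"
    using dyadic_lower_bound[of "\<epsilon> / 2"] assms by auto
  obtain \<delta> where \<delta>: "0 < \<delta>" and small': "\<And>a l E. \<lbrakk>0 < l; E \<in> sets lebesgue; E \<subseteq> hcube a l;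
      measure lebesgue E \<le> \<delta> * l ^ CARD('n)\<rbrakk> \<Longrightarrow> measure \<mu> E \<le> c / 2 * measure \<mu> (hcube a l)"
    using small[of "c / 2"] c by auto
  show ?thesis
  proof
    show "0 < c / 2" using c by simp
    fix a :: "real ^ 'n" and l E
    assume A: "0 < l" "E \<in> sets lebesgue" "E \<subseteq> hcube a l" "\<epsilon> * l ^ CARD('n) \<le> measure lebesgue E"
    have "0 < min (\<epsilon> / 2) \<delta> * l ^ CARD('n)"
      using A(1) assms \<delta> by simp
    then obtain D where D: "dyadic_set a l D"
      "measure lebesgue (E - D) < min (\<epsilon> / 2) \<delta> * l ^ CARD('n)"
      "measure lebesgue (D - E) < min (\<epsilon> / 2) \<delta> * l ^ CARD('n)"
      using dyadic_approximation[OF A(1-3)] by metis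
    have D': "D \<in> sets lebesgue" "D \<subseteq> hcube a l"
      using dyadic_set_sets dyadic_set_subset A(1) D(1) by blast+
    have le: "min (\<epsilon> / 2) \<delta> * l ^ CARD('n) \<le> \<epsilon> / 2 * l ^ CARD('n)"
      "min (\<epsilon> / 2) \<delta> * l ^ CARD('n) \<le> \<delta> * l ^ CARD('n)"
      using A(1) by (auto intro!: mult_right_mono)
    have "measure lebesgue (E - E \<inter> D) = measure lebesgue E - measure lebesgue (E \<inter> D)"
      "measure \<mu> (D - E \<inter> D) = measure \<mu> D - measure \<mu> (E \<inter> D)"
      using A D' by (auto intro!: measure_Diff_in_hcube[of _ _ a l])
    moreover have "E - E \<inter> D = E - D" "D - E \<inter> D = D - E" by auto
    ultimately have diff: "measure lebesgue (E - D) = measure lebesgue E - measure lebesgue (E \<inter> D)"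
      "measure \<mu> (D - E) = measure \<mu> D - measure \<mu> (E \<inter> D)" by simp_all
    have "measure lebesgue (E \<inter> D) \<le> measure lebesgue D"
      by (rule measure_mono_fmeasurable[OF _ _ fmeasurableI2[OF hcube_lmeasurable D'(2,1)]])
        (use A D' in auto)
    then have "\<epsilon> / 2 * l ^ CARD('n) \<le> measure lebesgue D"
      using A(4) D(2) diff(1) le(1) by (simp add: field_simps)
    then have "c * measure \<mu> (hcube a l) \<le> measure \<mu> D"
      by (rule dyadic[OF A(1) D(1)])
    moreover have "measure \<mu> (D - E) \<le> c / 2 * measure \<mu> (hcube a l)"
      using A D' less_imp_le[OF less_le_trans[OF D(3) le(2)]] by (intro small') auto
    moreover have "measure \<mu> (E \<inter> D) \<le> measure \<mu> E"
      using A D' by (intro measure_mono_in_hcube[of _ _ a l]) auto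
    ultimately show "c / 2 * measure \<mu> (hcube a l) \<le> measure \<mu> E"
      using diff(2) by (simp add: field_simps)
  qed
qed

end

section \<open>Reverse Hoelder weights\<close>

lemma average_cube:
  fixes a :: "real ^ 'n"
  assumes "0 < l"
  shows "average (cbox a (\<chi> i. a $ i + l)) f =
    ennreal (1 / l ^ CARD('n)) * (\<integral>\<^sup>+x\<in>hcube a l. f x \<partial>lebesgue)"
proof -
  have "(\<integral>\<^sup>+x\<in>cbox a (\<chi> i. a $ i + l). f x \<partial>lebesgue) = (\<integral>\<^sup>+x\<in>hcube a l. f x \<partial>lebesgue)"
    by (rule nn_integral_cong_AE)
      (use AE_hcube_iff_cbox[of a l] in eventually_elim, simp add: indicator_def)
  moreover have "1 / ennreal (l ^ CARD('n)) = ennreal (1 / l ^ CARD('n))"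
    using divide_ennreal[of 1 "l ^ CARD('n)"] assms by simp
  ultimately show ?thesis
    unfolding average_def emeasure_cube[OF assms] by simp
qed

lemma nn_integral_hcube_pos_finite:
  fixes a :: "real ^ 'n"
  assumes "weight w" "locally_integrable w" "0 < l"
  shows "0 < (\<integral>\<^sup>+x\<in>hcube a l. w x \<partial>lebesgue)" "(\<integral>\<^sup>+x\<in>hcube a l. w x \<partial>lebesgue) < \<infinity>"
proof -
  have w [measurable]: "w \<in> borel_measurable lebesgue" and pos: "AE x in lebesgue. 0 < w x"
    using assms(1) by (auto simp: weight_def)
  show "0 < (\<integral>\<^sup>+x\<in>hcube a l. w x \<partial>lebesgue)"
  proof (rule ccontr)
    assume "\<not> ?thesis"
    then have "AE x in lebesgue. w x * indicator (hcube a l) x = 0"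
      by (subst nn_integral_0_iff_AE[symmetric]) auto
    then have "AE x in lebesgue. x \<notin> hcube a l"
      using pos by eventually_elim (auto simp: indicator_def split: if_splits)
    then have "emeasure lebesgue (hcube a l) = 0"
      by (simp add: AE_iff_measurable[OF hcube_sets])
    then show False
      using emeasure_hcube[OF assms(3), of a] assms(3) by simp
  qed
  have "(\<integral>\<^sup>+x\<in>hcube a l. w x \<partial>lebesgue) \<le> (\<integral>\<^sup>+x\<in>cbox a (\<chi> i. a $ i + l). w x \<partial>lebesgue)"
    using hcube_subset_cbox by (intro nn_integral_mono) (auto simp: indicator_def)
  also have "\<dots> < \<infinity>"
    using assms(2) compact_cbox by (auto simp: locally_integrable_def)
  finally show "(\<integral>\<^sup>+x\<in>hcube a l. w x \<partial>lebesgue) < \<infinity>" .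
qed

lemma average_pos_finite:
  assumes "weight w" "locally_integrable w" "Q \<in> cubes"
  shows "0 < average Q w" "average Q w < \<infinity>"
proof -
  obtain a l where Q: "Q = cbox a (\<chi> i. a $ i + l)" "0 < l"
    using assms(3) by (auto simp: cubes_def)
  show "0 < average Q w" "average Q w < \<infinity>"
    using nn_integral_hcube_pos_finite[OF assms(1,2) Q(2), of a] Q(2)
    unfolding Q(1) average_cube[OF Q(2)]
    by (auto simp: ennreal_zero_less_mult_iff ennreal_mult_less_top)
qed

text \<open>
  Averages of a locally integrable weight are positive and finite, so the quotient in the reverse
  Hoelder constant can be multiplied out.
\<close>

lemma RH_bound:
  assumes "w \<in> RH s"
  shows "\<exists>K>0. \<forall>Q\<in>cubes.
    epowr (average Q (\<lambda>x. epowr (w x) s)) (1 / s) \<le> ennreal K * average Q w"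
proof (intro exI conjI ballI)
  have w: "weight w" "locally_integrable w" and c: "RH_const s w < \<infinity>"
    using assms by (auto simp: RH_def)
  let ?K = "enn2real (RH_const s w) + 1"
  show "0 < ?K"
    by (simp add: add_nonneg_pos)
  have le: "RH_const s w \<le> ennreal ?K"
    using c by (cases "RH_const s w") (auto simp: ennreal_leI)
  fix Q :: "(real ^ 'a) set"
  assume Q: "Q \<in> cubes"
  let ?X = "epowr (average Q (\<lambda>x. epowr (w x) s)) (1 / s)"
  note A = average_pos_finite[OF w Q]
  have "?X * inverse (average Q w) \<le> RH_const s w"
    unfolding RH_const_def by (rule SUP_upper[OF Q])
  then have "?X * inverse (average Q w) * average Q w \<le> ennreal ?K * average Q w"
    using le by (intro mult_right_mono) auto
  moreover have "inverse (average Q w) * average Q w = 1"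
    using A by (cases "average Q w") (auto simp: inverse_ennreal ennreal_mult[symmetric])
  ultimately show "?X \<le> ennreal ?K * average Q w"
    by (simp add: mult.assoc)
qed

lemma epowr_measurable [measurable]:
  assumes [measurable]: "f \<in> borel_measurable M"
  shows "(\<lambda>x. epowr (f x) p) \<in> borel_measurable M"
  unfolding epowr_def by measurable

text \<open>
  Where \<open>x > t\<close>, the factor \<open>(x / t) powr (s - 1)\<close> exceeds \<open>1\<close>. Integrating this bound with a suitable
  \<open>t\<close> is a substitute for Hoelder's inequality between \<open>w\<close> and an indicator function.
\<close>

lemma truncation_bound:
  assumes "1 < s" "0 < t"
  shows "x \<le> ennreal t + ennreal (t powr (1 - s)) * epowr x s"
proof (cases x)
  case (real r)
  show ?thesis
  proof (cases "r \<le> t")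
    case True
    then show ?thesis
      using real by (intro add_increasing2) (auto simp: ennreal_leI)
  next
    case False
    then have "r powr (1 - s) \<le> t powr (1 - s)"
      using assms by (intro powr_mono2') auto
    then have "r powr (1 - s) * r powr s \<le> t powr (1 - s) * r powr s"
      by (intro mult_right_mono) auto
    moreover have "r powr (1 - s) * r powr s = r"
      using False assms by (simp add: powr_add[symmetric])
    ultimately have "r \<le> t powr (1 - s) * r powr s" by simp
    then show ?thesis
      using real by (intro add_increasing) (auto simp: epowr_def ennreal_mult[symmetric] ennreal_leI)
  qed
next
  case top
  then show ?thesis
    using assms by (simp add: epowr_def ennreal_mult_eq_top_iff)
qed

lemma RH_nn_integral_powr_bound:
  fixes a :: "real ^ 'n"
  assumes "1 < s" "0 < K" "0 < l" "0 \<le> M"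
    and bound: "epowr (average (cbox a (\<chi> i. a $ i + l)) (\<lambda>x. epowr (w x) s)) (1 / s)
      \<le> ennreal K * average (cbox a (\<chi> i. a $ i + l)) w"
    and M: "(\<integral>\<^sup>+x\<in>hcube a l. w x \<partial>lebesgue) = ennreal M"
  shows "(\<integral>\<^sup>+x\<in>hcube a l. epowr (w x) s \<partial>lebesgue)
    \<le> ennreal (l ^ CARD('n) * (K * (M / l ^ CARD('n))) powr s)"
proof -
  define v where "v = l ^ CARD('n)"
  have v: "0 < v" using assms by (simp add: v_def)
  let ?J = "\<integral>\<^sup>+x\<in>hcube a l. epowr (w x) s \<partial>lebesgue"
  have *: "epowr (ennreal (1 / v) * ?J) (1 / s) \<le> ennreal (K * (M / v))"
    using bound v assms unfolding average_cube[OF assms(3)] M v_def[symmetric]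
    by (simp add: ennreal_mult[symmetric])
  show ?thesis
  proof (cases ?J)
    case (real J)
    have "(J / v) powr (1 / s) \<le> K * (M / v)"
      using * real v assms by (simp add: epowr_def ennreal_mult[symmetric] ennreal_le_iff)
    then have "((J / v) powr (1 / s)) powr s \<le> (K * (M / v)) powr s"
      using assms by (intro powr_mono2) auto
    then have "J / v \<le> (K * (M / v)) powr s"
      using real v assms by (simp add: powr_powr)
    then have "J \<le> v * (K * (M / v)) powr s"
      using v by (simp add: field_simps)
    then show ?thesis
      using real by (simp add: v_def ennreal_leI)
  next
    case top
    then show ?thesis
      using * v by (simp add: epowr_def ennreal_mult_eq_top_iff top_unique)
  qed
qed

text \<open>
  Truncate \<open>w\<close> at the level \<open>t = T \<cdot> average Q w\<close>. The mass of \<open>E\<close> below the level is at most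
  \<open>t |E|\<close>, a multiple \<open>T |E| / |Q|\<close> of \<open>w(Q)\<close>; the mass above it is, by the reverse Hoelder
  condition, at most \<open>T powr (1 - s) * K powr s\<close> times \<open>w(Q)\<close>. Choose first \<open>T\<close> large, then
  \<open>|E| / |Q|\<close> small.
\<close>

lemma RH_uniformly_small:
  fixes w :: "real ^ 'n \<Rightarrow> ennreal"
  assumes "1 < s" "w \<in> RH s"
  shows "uniformly_small_on_cubes (density lebesgue w)"
proof
  have w: "weight w" "locally_integrable w"
    using assms(2) by (auto simp: RH_def)
  then have [measurable]: "w \<in> borel_measurable lebesgue" by (simp add: weight_def)
  show "sets (density lebesgue w) = sets lebesgue" by simp
  show hcube_finite: "emeasure (density lebesgue w) (hcube a l) < \<infinity>" for a l
  proof (cases "0 < l")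
    case True
    then show ?thesis
      using nn_integral_hcube_pos_finite[OF w True, of a] by (simp add: emeasure_density)
  next
    case False
    then have "hcube a l = {}" by (auto simp: hcube_def)
    then show ?thesis by simp
  qed
  fix \<kappa> :: real assume \<kappa>: "0 < \<kappa>"
  obtain K where K: "0 < K" "\<And>Q. Q \<in> cubes \<Longrightarrow>
      epowr (average Q (\<lambda>x. epowr (w x) s)) (1 / s) \<le> ennreal K * average Q w"
    using RH_bound[OF assms(2)] by metis
  \<comment> \<open>The solution of \<open>T powr (1 - s) * K powr s = \<kappa> / 2\<close>.\<close>
  define T where "T = (2 * K powr s / \<kappa>) powr (1 / (s - 1))"
  have T: "0 < T" using K \<kappa> by (simp add: T_def)
  have "T powr (1 - s) = (2 * K powr s / \<kappa>) powr (- 1)"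
    using assms(1) unfolding T_def powr_powr by (intro arg_cong2[where f="(powr)"]) (auto simp: field_simps)
  also have "\<dots> = \<kappa> / (2 * K powr s)"
    using K \<kappa> by (subst powr_minus) simp
  finally have T_eq: "T powr (1 - s) * K powr s = \<kappa> / 2"
    using K by simp
  show "\<exists>\<delta>>0. \<forall>a l E. 0 < l \<longrightarrow> E \<in> sets lebesgue \<longrightarrow> E \<subseteq> hcube a l \<longrightarrow>
      measure lebesgue E \<le> \<delta> * l ^ CARD('n) \<longrightarrow>
      measure (density lebesgue w) E \<le> \<kappa> * measure (density lebesgue w) (hcube a l)"
  proof (intro exI[of _ "\<kappa> / (2 * T)"] conjI allI impI)
    show "0 < \<kappa> / (2 * T)" using \<kappa> T by simp
    fix a :: "real ^ 'n" and l E
    assume l: "0 < l" and E [measurable]: "E \<in> sets lebesgue" and sub: "E \<subseteq> hcube a l"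
      and le: "measure lebesgue E \<le> \<kappa> / (2 * T) * l ^ CARD('n)"
    define v where "v = l ^ CARD('n)"
    define M where "M = measure (density lebesgue w) (hcube a l)"
    have v: "0 < v" using l by (simp add: v_def)
    have M_eq: "(\<integral>\<^sup>+x\<in>hcube a l. w x \<partial>lebesgue) = ennreal M"
      using hcube_finite[of a l] unfolding M_def
      by (subst emeasure_eq_ennreal_measure[symmetric]) (auto simp: emeasure_density)
    have M: "0 < M"
      using nn_integral_hcube_pos_finite(1)[OF w l, of a] unfolding M_eq by simp
    have J: "(\<integral>\<^sup>+x\<in>hcube a l. epowr (w x) s \<partial>lebesgue) \<le> ennreal (v * (K * (M / v)) powr s)"
      unfolding v_def
      by (rule RH_nn_integral_powr_bound[OF assms(1) K(1) l _ K(2) M_eq])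
        (use M l in \<open>auto simp: cubes_def\<close>)
    define t where "t = T * (M / v)"
    have t: "0 < t" using T M v by (simp add: t_def)
    have E_fin: "emeasure lebesgue E = ennreal (measure lebesgue E)"
      using fmeasurableI2[OF hcube_lmeasurable sub E] by (rule emeasure_eq_measure2)
    have "emeasure (density lebesgue w) E = (\<integral>\<^sup>+x. w x * indicator E x \<partial>lebesgue)"
      by (simp add: emeasure_density)
    also have "\<dots> \<le> (\<integral>\<^sup>+x. ennreal t * indicator E x
        + ennreal (t powr (1 - s)) * (epowr (w x) s * indicator (hcube a l) x) \<partial>lebesgue)"
    proof (intro nn_integral_mono)
      fix x
      show "w x * indicator E x \<le> ennreal t * indicator E x
        + ennreal (t powr (1 - s)) * (epowr (w x) s * indicator (hcube a l) x)"
        using truncation_bound[OF assms(1) t, of "w x"] sub by (auto simp: indicator_def)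
    qed
    also have "\<dots> = ennreal t * emeasure lebesgue E
        + ennreal (t powr (1 - s)) * (\<integral>\<^sup>+x\<in>hcube a l. epowr (w x) s \<partial>lebesgue)"
      by (simp add: nn_integral_add nn_integral_cmult nn_integral_cmult_indicator)
    also have "\<dots> \<le> ennreal t * ennreal (measure lebesgue E)
        + ennreal (t powr (1 - s)) * ennreal (v * (K * (M / v)) powr s)"
      unfolding E_fin by (intro add_mono mult_left_mono J) auto
    also have "\<dots> = ennreal (t * measure lebesgue E + t powr (1 - s) * (v * (K * (M / v)) powr s))"
      using t v by (simp add: ennreal_mult[symmetric] ennreal_plus[symmetric] del: ennreal_plus)
    also have "\<dots> \<le> ennreal (\<kappa> * M)"
    proof (rule ennreal_leI)
      have "t * measure lebesgue E \<le> t * (\<kappa> / (2 * T) * v)"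
        using le t unfolding v_def by (intro mult_left_mono) auto
      also have "\<dots> = \<kappa> / 2 * M"
        using T v by (simp add: t_def field_simps)
      finally have 1: "t * measure lebesgue E \<le> \<kappa> / 2 * M" .
      have "t powr (1 - s) * (v * (K * (M / v)) powr s)
          = (T powr (1 - s) * K powr s) * (v * ((M / v) powr (1 - s) * (M / v) powr s))"
        unfolding t_def powr_mult[of T] powr_mult[of K] by (simp only: mult_ac)
      also have "(M / v) powr (1 - s) * (M / v) powr s = M / v"
        using M v by (simp add: powr_add[symmetric])
      finally have "t powr (1 - s) * (v * (K * (M / v)) powr s) = \<kappa> / 2 * M"
        using v unfolding T_eq by simp
      with 1 show "t * measure lebesgue E + t powr (1 - s) * (v * (K * (M / v)) powr s) \<le> \<kappa> * M"
        by simp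
    qed
    finally show "measure (density lebesgue w) E \<le> \<kappa> * measure (density lebesgue w) (hcube a l)"
      using \<kappa> M unfolding M_def[symmetric] measure_def[of _ E] by (intro enn2real_leI) auto
  qed
qed

text \<open>
  The set where \<open>w\<close> is below \<open>c / 2\<close> times its average has mass at most \<open>c / 2 * w(Q)\<close>. This is
  less than the mass \<open>c * w(Q)\<close> that it would carry if its proportion in \<open>Q\<close> exceeded \<open>\<epsilon>\<close>.
\<close>

lemma RH_sublevel_small:
  fixes w :: "real ^ 'n \<Rightarrow> ennreal"
  assumes "1 < s" "w \<in> RH s" "0 < \<epsilon>"
  shows "\<exists>\<tau>>0. \<forall>Q\<in>cubes.
    emeasure lebesgue {x \<in> Q. w x < ennreal \<tau> * average Q w} \<le> ennreal \<epsilon> * emeasure lebesgue Q"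
proof -
  interpret uniformly_small_on_cubes "density lebesgue w"
    by (rule RH_uniformly_small[OF assms(1,2)])
  have w: "weight w" "locally_integrable w"
    using assms(2) by (auto simp: RH_def)
  then have [measurable]: "w \<in> borel_measurable lebesgue" by (simp add: weight_def)
  obtain c where c: "0 < c" and lower: "\<And>a l E. \<lbrakk>0 < l; E \<in> sets lebesgue; E \<subseteq> hcube a l;
      \<epsilon> * l ^ CARD('n) \<le> measure lebesgue E\<rbrakk>
      \<Longrightarrow> c * measure (density lebesgue w) (hcube a l) \<le> measure (density lebesgue w) E"
    using uniform_lower_bound[OF assms(3)] by metis
  show ?thesis
  proof (intro exI conjI ballI)
    show "0 < c / 2" using c by simp
    fix Q :: "(real ^ 'n) set" assume "Q \<in> cubes"
    then obtain a l where Q: "Q = cbox a (\<chi> i. a $ i + l)" and l: "0 < l"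
      by (auto simp: cubes_def)
    have sublevel_sets: "{x \<in> A. w x < u} \<in> sets lebesgue"
      if [measurable]: "A \<in> sets lebesgue" for A u
      by measurable
    define v where "v = l ^ CARD('n)"
    define M where "M = measure (density lebesgue w) (hcube a l)"
    have v: "0 < v" using l by (simp add: v_def)
    have M_eq: "(\<integral>\<^sup>+x\<in>hcube a l. w x \<partial>lebesgue) = ennreal M"
      using finite_hcube[of a l] unfolding M_def
      by (subst emeasure_eq_ennreal_measure[symmetric]) (auto simp: emeasure_density)
    have M: "0 < M"
      using nn_integral_hcube_pos_finite(1)[OF w l, of a] unfolding M_eq by simp
    have avg: "average Q w = ennreal (M / v)"
      using M v unfolding Q average_cube[OF l] M_eq v_def[symmetric] by (simp add: ennreal_mult[symmetric])
    define E where "E = {x \<in> hcube a l. w x < ennreal (c / 2) * average Q w}"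
    have E [measurable]: "E \<in> sets lebesgue"
      unfolding E_def by measurable
    have sub: "E \<subseteq> hcube a l" by (auto simp: E_def)
    have E_fin: "emeasure lebesgue E = ennreal (measure lebesgue E)"
      using fmeasurableI2[OF hcube_lmeasurable sub E] by (rule emeasure_eq_measure2)
    have E_le: "measure lebesgue E \<le> v"
      using measure_mono_fmeasurable[OF sub E hcube_lmeasurable] measure_hcube[OF l, of a]
      by (simp add: v_def)
    have "measure lebesgue E \<le> \<epsilon> * v"
    proof (rule ccontr)
      assume "\<not> ?thesis"
      then have "c * M \<le> measure (density lebesgue w) E"
        unfolding M_def by (intro lower l E sub) (simp add: v_def)
      also have "\<dots> \<le> c / 2 * M"
      proof -
        have "emeasure (density lebesgue w) E = (\<integral>\<^sup>+x. w x * indicator E x \<partial>lebesgue)"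
          by (simp add: emeasure_density)
        also have "\<dots> \<le> (\<integral>\<^sup>+x. ennreal (c / 2 * (M / v)) * indicator E x \<partial>lebesgue)"
          using c M v by (intro nn_integral_mono)
            (auto simp: E_def avg indicator_def ennreal_mult[symmetric] less_imp_le)
        also have "\<dots> = ennreal (c / 2 * (M / v) * measure lebesgue E)"
          using c M v by (simp add: nn_integral_cmult_indicator E_fin ennreal_mult[symmetric])
        also have "\<dots> \<le> ennreal (c / 2 * (M / v) * v)"
          using c M v E_le by (intro ennreal_leI mult_left_mono) auto
        finally show ?thesis
          using c M v unfolding measure_def[of _ E] by (intro enn2real_leI) auto
      qed
      finally show False using c M by simp
    qed
    moreover have "emeasure lebesgue {x \<in> Q. w x < ennreal (c / 2) * average Q w} = emeasure lebesgue E"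
    proof (rule emeasure_eq_AE)
      show "AE x in lebesgue. x \<in> {x \<in> Q. w x < ennreal (c / 2) * average Q w} \<longleftrightarrow> x \<in> E"
        using AE_hcube_iff_cbox[of a l] by eventually_elim (simp add: E_def Q)
      show "{x \<in> Q. w x < ennreal (c / 2) * average Q w} \<in> sets lebesgue"
        by (rule sublevel_sets) (simp_all add: Q)
    qed (rule E)
    ultimately show "emeasure lebesgue {x \<in> Q. w x < ennreal (c / 2) * average Q w}
        \<le> ennreal \<epsilon> * emeasure lebesgue Q"
      using v assms(3) unfolding E_fin Q emeasure_cube[OF l] v_def[symmetric]
      by (simp add: ennreal_mult[symmetric] ennreal_leI)
  qed
qed

section \<open>The product of several weights\<close>

text \<open>
  The sets on which some \<open>w i\<close> falls below its level \<open>h i\<close> have total measure at most \<open>|Q| / 2\<close>;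
  on the remaining half \<open>G\<close> of the cube the product is at least \<open>\<Prod>i\<in>I. h i\<close>.
\<close>

lemma prod_le_average_prod:
  fixes w :: "'i \<Rightarrow> real ^ 'n \<Rightarrow> ennreal"
  assumes I: "finite I" "I \<noteq> {}"
    and Q: "Q \<in> cubes"
    and w [measurable]: "\<And>i. i \<in> I \<Longrightarrow> w i \<in> borel_measurable lebesgue"
    and small: "\<And>i. i \<in> I \<Longrightarrow>
      emeasure lebesgue {x \<in> Q. w i x < h i} \<le> ennreal (1 / (2 * card I)) * emeasure lebesgue Q"
  shows "(\<Prod>i\<in>I. h i) \<le> 2 * average Q (\<lambda>x. \<Prod>i\<in>I. w i x)"
proof -
  obtain a l where Q_eq: "Q = cbox a (\<chi> i. a $ i + l)" and l: "0 < l"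
    using Q by (auto simp: cubes_def)
  define v where "v = l ^ CARD('n)"
  have v: "0 < v" using l by (simp add: v_def)
  have Qv: "emeasure lebesgue Q = ennreal v"
    unfolding Q_eq v_def by (rule emeasure_cube[OF l])
  have Q_sets [measurable]: "Q \<in> sets lebesgue" by (simp add: Q_eq)
  define B where "B i = {x \<in> Q. w i x < h i}" for i
  have B [measurable]: "B i \<in> sets lebesgue" if "i \<in> I" for i
    unfolding B_def using that by measurable
  define G where "G = Q - (\<Union>i\<in>I. B i)"
  have G [measurable]: "G \<in> sets lebesgue"
    unfolding G_def using I(1) B by (intro sets.Diff Q_sets sets.finite_UN) auto
  have UB: "(\<Union>i\<in>I. B i) \<in> sets lebesgue"
    using I(1) B by (intro sets.finite_UN) auto
  have "emeasure lebesgue Q \<le> emeasure lebesgue (G \<union> (\<Union>i\<in>I. B i))"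
    by (intro emeasure_mono sets.Un G UB) (auto simp: G_def)
  also have "\<dots> \<le> emeasure lebesgue G + emeasure lebesgue (\<Union>i\<in>I. B i)"
    by (intro emeasure_subadditive G UB)
  also have "emeasure lebesgue (\<Union>i\<in>I. B i) \<le> (\<Sum>i\<in>I. emeasure lebesgue (B i))"
    using B I(1) by (intro emeasure_subadditive_finite) auto
  also have "\<dots> \<le> (\<Sum>i\<in>I. ennreal (1 / (2 * card I)) * ennreal v)"
    using small unfolding B_def Qv by (intro sum_mono) auto
  also have "\<dots> = ennreal (v / 2)"
    using I v by (simp add: ennreal_mult[symmetric] ennreal_of_nat_eq_real_of_nat)
  finally have half: "ennreal v \<le> emeasure lebesgue G + ennreal (v / 2)"
    unfolding Qv by (simp add: add_left_mono)
  have G_ge: "ennreal (v / 2) \<le> emeasure lebesgue G"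
  proof (cases "emeasure lebesgue G")
    case (real g)
    then show ?thesis
      using half v by (simp add: ennreal_plus[symmetric] ennreal_le_iff del: ennreal_plus)
  qed simp
  let ?P = "\<Prod>i\<in>I. h i"
  have "?P * ennreal (v / 2) \<le> ?P * emeasure lebesgue G"
    by (intro mult_left_mono G_ge) auto
  also have "\<dots> = (\<integral>\<^sup>+x. ?P * indicator G x \<partial>lebesgue)"
    by (simp add: nn_integral_cmult_indicator)
  also have "\<dots> \<le> (\<integral>\<^sup>+x\<in>hcube a l. (\<Prod>i\<in>I. w i x) \<partial>lebesgue)"
  proof (rule nn_integral_mono_AE)
    show "AE x in lebesgue. ?P * indicator G x \<le> (\<Prod>i\<in>I. w i x) * indicator (hcube a l) x"
      using AE_hcube_iff_cbox[of a l]
    proof eventually_elim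
      case (elim x)
      show ?case
      proof (cases "x \<in> G")
        case True
        then have "h i \<le> w i x" if "i \<in> I" for i
          using that by (auto simp: G_def B_def not_less)
        then have "?P \<le> (\<Prod>i\<in>I. w i x)" by (rule prod_mono_ennreal)
        moreover have "x \<in> hcube a l"
          using True elim by (simp add: G_def Q_eq)
        ultimately show ?thesis using True by simp
      qed simp
    qed
  qed
  finally have "ennreal (2 / v) * (?P * ennreal (v / 2))
      \<le> ennreal (2 / v) * (\<integral>\<^sup>+x\<in>hcube a l. (\<Prod>i\<in>I. w i x) \<partial>lebesgue)"
    by (intro mult_left_mono) auto
  moreover have "ennreal (2 / v) * (?P * ennreal (v / 2)) = ?P"
  proof -
    have "ennreal (2 / v) * (?P * ennreal (v / 2)) = ?P * (ennreal (2 / v) * ennreal (v / 2))"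
      by (simp only: mult_ac)
    also have "ennreal (2 / v) * ennreal (v / 2) = 1"
      using v by (subst ennreal_mult[symmetric]) auto
    finally show ?thesis by simp
  qed
  moreover have "ennreal (2 / v) * X = 2 * (ennreal (1 / v) * X)" for X
  proof -
    have "ennreal (2 / v) = ennreal 2 * ennreal (1 / v)"
      using v by (subst ennreal_mult[symmetric]) auto
    then show ?thesis by (simp add: mult.assoc)
  qed
  ultimately show ?thesis
    unfolding Q_eq average_cube[OF l] v_def[symmetric] by simp
qed

theorem theorem1p1:
  fixes m :: nat and s :: "nat \<Rightarrow> real" and w :: "nat \<Rightarrow> real ^ 'n \<Rightarrow> ennreal"
  assumes "m > 0"
    and "\<And>i. i \<in> {1..m} \<Longrightarrow> 1 < s i"
    and "(\<Sum>i = 1..m. 1 / s i) = 1"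
    and "\<And>i. i \<in> {1..m} \<Longrightarrow> weight (w i)"
    and "\<And>i. i \<in> {1..m} \<Longrightarrow> w i \<in> RH (s i)"
  shows "\<exists>C::ennreal. C < \<infinity> \<and>
    (\<forall>Q \<in> cubes.
       (\<Prod>i = 1..m. epowr (average Q (\<lambda>x. epowr (w i x) (s i))) (1 / s i))
         \<le> C * average Q (\<lambda>x. \<Prod>i = 1..m. w i x))"
proof -
  have "\<forall>i\<in>{1..m}. \<exists>K. 0 < K \<and> (\<forall>Q\<in>cubes.
      epowr (average Q (\<lambda>x. epowr (w i x) (s i))) (1 / s i) \<le> ennreal K * average Q (w i))"
    by (intro ballI RH_bound assms(5))
  from bchoice[OF this] obtain K where K: "\<forall>i\<in>{1..m}. 0 < K i \<and> (\<forall>Q\<in>cubes.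
      epowr (average Q (\<lambda>x. epowr (w i x) (s i))) (1 / s i) \<le> ennreal (K i) * average Q (w i))" ..
  have "0 < 1 / (2 * real m)"
    using assms(1) by simp
  then have "\<forall>i\<in>{1..m}. \<exists>\<tau>. 0 < \<tau> \<and> (\<forall>Q\<in>cubes.
      emeasure lebesgue {x \<in> Q. w i x < ennreal \<tau> * average Q (w i)}
        \<le> ennreal (1 / (2 * real m)) * emeasure lebesgue Q)"
    by (intro ballI RH_sublevel_small[OF assms(2,5)])
  from bchoice[OF this] obtain \<tau> where \<tau>: "\<forall>i\<in>{1..m}. 0 < \<tau> i \<and> (\<forall>Q\<in>cubes.
      emeasure lebesgue {x \<in> Q. w i x < ennreal (\<tau> i) * average Q (w i)}
        \<le> ennreal (1 / (2 * real m)) * emeasure lebesgue Q)" ..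
  define C where "C = (\<Prod>i = 1..m. ennreal (K i / \<tau> i)) * 2"
  show ?thesis
  proof (intro exI[of _ C] conjI ballI)
    show "C < \<infinity>"
    proof -
      have "(\<Prod>i = 1..m. ennreal (K i / \<tau> i)) \<noteq> top"
        by (simp add: ennreal_prod_eq_top)
      then show ?thesis
        unfolding C_def by (simp add: ennreal_mult_less_top less_top)
    qed
    fix Q :: "(real ^ 'n) set" assume Q: "Q \<in> cubes"
    have "(\<Prod>i = 1..m. epowr (average Q (\<lambda>x. epowr (w i x) (s i))) (1 / s i))
        \<le> (\<Prod>i = 1..m. ennreal (K i / \<tau> i) * (ennreal (\<tau> i) * average Q (w i)))"
    proof (rule prod_mono_ennreal)
      fix i assume i: "i \<in> {1..m}"
      have pos: "0 < K i" "0 < \<tau> i"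
        using bspec[OF K i] bspec[OF \<tau> i] by simp_all
      have "ennreal (K i / \<tau> i) * ennreal (\<tau> i) = ennreal (K i)"
        using pos by (subst ennreal_mult[symmetric]) auto
      then show "epowr (average Q (\<lambda>x. epowr (w i x) (s i))) (1 / s i)
          \<le> ennreal (K i / \<tau> i) * (ennreal (\<tau> i) * average Q (w i))"
        using bspec[OF K i] Q by (simp add: mult.assoc[symmetric])
    qed
    also have "\<dots> = (\<Prod>i = 1..m. ennreal (K i / \<tau> i)) * (\<Prod>i = 1..m. ennreal (\<tau> i) * average Q (w i))"
      by (rule prod.distrib)
    also have "\<dots> \<le> (\<Prod>i = 1..m. ennreal (K i / \<tau> i)) * (2 * average Q (\<lambda>x. \<Prod>i = 1..m. w i x))"
      using assms(1,4) Q \<tau> by (intro mult_left_mono prod_le_average_prod) (auto simp: weight_def)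
    finally show "(\<Prod>i = 1..m. epowr (average Q (\<lambda>x. epowr (w i x) (s i))) (1 / s i))
        \<le> C * average Q (\<lambda>x. \<Prod>i = 1..m. w i x)"
      by (simp add: C_def mult.assoc)
  qed
qed

end
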